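(* Let $z_1,\dots,z_J$ be distinct points of the unit circle, $\phi(z)=\prod_{j=1}^J(1-\overline{z_j}z)$, and let $(a_n)_{n\ge0}$ be a sequence of complex numbers with $a_n\ne1$ for all $n$ and $\lim_{n\to\infty}n(1-a_n)=p$, where $p>0$ is real. Let $H(K)$ be the reproducing kernel Hilbert space with orthonormal basis $f_n(z)=z^n\phi(a_nz)$, $n\ge0$, and kernel $K(z,\zeta)=\sum_{n=0}^\infty f_n(z)\overline{f_n(\zeta)}$. Then for every $f\in H(K)$ there exist $g\in H^2(\mathbb{D})$ and constants $b_1,b_2,\dots,b_J\in\mathbb{C}$ such that $$f(z)=\phi(z)g(z)+b_1K(z,z_1)+\cdots+b_JK(z,z_J)\qquad(z\in\mathbb{D}).$$
   Context: $J\ge1$ is an integer. The elements of $H(K)$ are the functions $f=\sum_n\alpha_nf_n$ with $(\alpha_n)\in\ell^2$ and $\|f\|=\|(\alpha_n)\|_{\ell^2}$; they are defined on $\mathbb{D}\cup\{z_1,\dots,z_J\}$ (where $\sum_n|f_n(z)|^2<\infty$) and analytic on the open unit disc $\mathbb{D}$. $K(z,z_j)=\sum_n f_n(z)\overline{f_n(z_j)}$ is regarded as a function of $z$. $H^2(\mathbb{D})$ is the Hardy space. *)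

theory Defs
  imports "HOL-Complex_Analysis.Complex_Analysis"
begin

definition phi :: "nat \<Rightarrow> (nat \<Rightarrow> complex) \<Rightarrow> complex \<Rightarrow> complex" where
  "phi J \<zeta> z = (\<Prod>j=1..J. 1 - cnj (\<zeta> j) * z)"

definition basis_fun ::
    "nat \<Rightarrow> (nat \<Rightarrow> complex) \<Rightarrow> (nat \<Rightarrow> complex) \<Rightarrow> nat \<Rightarrow> complex \<Rightarrow> complex" where
  "basis_fun J \<zeta> a n z = z ^ n * phi J \<zeta> (a n * z)"

definition kernel_of :: "(nat \<Rightarrow> complex \<Rightarrow> complex) \<Rightarrow> complex \<Rightarrow> complex \<Rightarrow> complex" where
  "kernel_of f z w = (\<Sum>n. f n z * cnj (f n w))"

(* The elements of the space H(K) of functions on X with orthonormal basis f.  HOL functions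
   are total, so only the values on X are constrained; the norm of F, the l2 norm of the
   (for the basis above unique) coefficient sequence, is not needed. *)
definition rkhs_on :: "complex set \<Rightarrow> (nat \<Rightarrow> complex \<Rightarrow> complex) \<Rightarrow> (complex \<Rightarrow> complex) set" where
  "rkhs_on X f = {F. \<exists>\<alpha>. summable (\<lambda>n. (norm (\<alpha> n))\<^sup>2) \<and>
                         (\<forall>z\<in>X. (\<lambda>n. \<alpha> n * f n z) sums F z)}"

definition hardy2 :: "(complex \<Rightarrow> complex) set" where
  "hardy2 = {g. g holomorphic_on ball 0 1 \<and>
     bdd_above ((\<lambda>r. 1 / (2 * pi) * integral {0..2 * pi} (\<lambda>t. (norm (g (of_real r * cis t)))\<^sup>2))
                ` {0<..<1})}"

end

theory Submission
  imports Defs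
begin

text \<open>
  Write \<open>F = (\<Sum>n. \<alpha> n * f n)\<close> for the basis functions \<open>f n z = z ^ n * phi (a n * z)\<close>. The kernel
  function \<open>K(\<cdot>, \<zeta> j)\<close> is the element of the space with coefficients \<open>v j n = cnj (f n (\<zeta> j))\<close>; these
  are square-summable because \<open>phi\<close> vanishes at \<open>\<zeta> j\<close> and \<open>a n - 1 = O(1/n)\<close>. Let \<open>b\<close> be such
  that \<open>\<beta> = \<alpha> - (\<Sum>j. b j * v j)\<close> is the orthogonal projection of \<open>\<alpha>\<close> onto the complement of the
  span of the \<open>v j\<close> (\<open>l2_orthogonal_remainder\<close>). Orthogonality to \<open>v j\<close> says that
  \<open>(\<Sum>n. \<beta> n * f n)\<close>, which is \<open>F\<close> minus a combination of kernel functions, vanishes at \<open>\<zeta> j\<close>.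
  What remains is to see that an element of the space that vanishes at every \<open>\<zeta> j\<close> is \<open>phi\<close>
  times a Hardy function.

  For this, compare \<open>phi (a n * z)\<close> with \<open>phi z\<close>: expanding \<open>phi\<close> in powers of \<open>z\<close> gives
  \<open>(\<Sum>n. \<beta> n * f n z) = phi z * h z + R z\<close>, where \<open>h z = (\<Sum>n. \<beta> n * z ^ n)\<close> is in the Hardy space
  and, since \<open>a n ^ k - 1 = O(1/n)\<close>, the coefficients \<open>r n\<close> of \<open>R\<close> satisfy
  \<open>(\<Sum>n. (n * norm (r n))\<^sup>2) < \<infinity>\<close> (\<open>sobolev_series_perturbed_polynomial\<close>). In particular \<open>R\<close>
  is given by its power series on the closed disc, and \<open>R (\<zeta> j) = 0\<close>. By partial fractions
  \<open>R / phi\<close> is a combination of the functions \<open>R z / (1 - cnj (\<zeta> j) * z)\<close>, and each of these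
  is in the Hardy space by the discrete Hardy inequality
  (\<open>l2_partial_sums\<close>, \<open>l2_series_divide_boundary_zero\<close>).
\<close>

section \<open>Square-summable sequences\<close>

definition l2 :: "(nat \<Rightarrow> complex) \<Rightarrow> bool" where
  "l2 x \<longleftrightarrow> summable (\<lambda>n. (norm (x n))\<^sup>2)"

lemma l2_dominated:
  assumes "l2 y" and "\<And>n. norm (x n) \<le> C * norm (y n)"
  shows "l2 x"
  unfolding l2_def
proof (rule summable_comparison_test)
  have "norm ((norm (x n))\<^sup>2) \<le> C\<^sup>2 * (norm (y n))\<^sup>2" for n
    using power_mono[OF assms(2)[of n], of 2] by (simp add: power_mult_distrib)
  then show "\<exists>N. \<forall>n\<ge>N. norm ((norm (x n))\<^sup>2) \<le> C\<^sup>2 * (norm (y n))\<^sup>2" by blast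
  show "summable (\<lambda>n. C\<^sup>2 * (norm (y n))\<^sup>2)"
    using assms(1) by (intro summable_mult) (simp add: l2_def)
qed

lemma l2_add:
  assumes "l2 x" "l2 y" shows "l2 (\<lambda>n. x n + y n)"
  unfolding l2_def
proof (rule summable_comparison_test)
  have "norm ((norm (x n + y n))\<^sup>2) \<le> 2 * (norm (x n))\<^sup>2 + 2 * (norm (y n))\<^sup>2" for n
  proof -
    have "(norm (x n + y n))\<^sup>2 \<le> (norm (x n) + norm (y n))\<^sup>2"
      by (intro power_mono norm_triangle_ineq) auto
    also have "\<dots> \<le> 2 * (norm (x n))\<^sup>2 + 2 * (norm (y n))\<^sup>2"
      using zero_le_power2[of "norm (x n) - norm (y n)"] by (simp add: power2_eq_square algebra_simps)
    finally show ?thesis by simp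
  qed
  then show "\<exists>N. \<forall>n\<ge>N. norm ((norm (x n + y n))\<^sup>2) \<le> 2 * (norm (x n))\<^sup>2 + 2 * (norm (y n))\<^sup>2"
    by blast
  show "summable (\<lambda>n. 2 * (norm (x n))\<^sup>2 + 2 * (norm (y n))\<^sup>2)"
    using assms by (intro summable_add summable_mult) (simp_all add: l2_def)
qed

lemma l2_cmult: "l2 x \<Longrightarrow> l2 (\<lambda>n. c * x n)"
  by (rule l2_dominated[of x _ "norm c"]) (auto simp: norm_mult)

lemma l2_sum: "(\<And>i. i \<in> I \<Longrightarrow> l2 (x i)) \<Longrightarrow> l2 (\<lambda>n. \<Sum>i\<in>I. x i n)"
proof (induction I rule: infinite_finite_induct)
  case (insert i I)
  then show ?case by (simp add: l2_add)
qed (simp_all add: l2_def)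

lemma l2_diff: "l2 x \<Longrightarrow> l2 y \<Longrightarrow> l2 (\<lambda>n. x n - y n)"
  using l2_add[of x "\<lambda>n. (-1) * y n"] l2_cmult[of y "-1"] by simp

lemma l2_mult_Bseq:
  assumes "Bseq u" "l2 x" shows "l2 (\<lambda>n. u n * x n)"
proof -
  obtain B where "\<And>n. norm (u n) \<le> B" using assms(1) by (metis BseqE)
  then show ?thesis
    by (intro l2_dominated[OF assms(2), of _ B]) (auto simp: norm_mult intro: mult_right_mono)
qed

lemma l2_mult_summable:
  assumes "l2 x" "l2 y" shows "summable (\<lambda>n. norm (x n * y n))"
proof (rule summable_comparison_test)
  have "norm (norm (x n * y n)) \<le> (norm (x n))\<^sup>2 + (norm (y n))\<^sup>2" for n
  proof -
    have "0 \<le> (norm (x n) - norm (y n))\<^sup>2 + (norm (x n))\<^sup>2 + (norm (y n))\<^sup>2" by simp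
    then show ?thesis unfolding power2_diff by (simp add: norm_mult)
  qed
  then show "\<exists>N. \<forall>n\<ge>N. norm (norm (x n * y n)) \<le> (norm (x n))\<^sup>2 + (norm (y n))\<^sup>2" by blast
  show "summable (\<lambda>n. (norm (x n))\<^sup>2 + (norm (y n))\<^sup>2)"
    using assms by (intro summable_add) (simp_all add: l2_def)
qed

lemma l2_power:
  assumes "norm (z::complex) < 1" shows "l2 (\<lambda>n. z ^ n)"
proof -
  have "(norm z)\<^sup>2 < 1" using assms by (simp add: power_less_one_iff)
  then show ?thesis
    unfolding l2_def norm_power power_mult[symmetric]
    by (subst mult.commute) (simp add: power_mult summable_geometric)
qed

lemma l2_inverse: "l2 (\<lambda>n. 1 / of_nat (Suc n))"
proof -
  have "summable (\<lambda>n. inverse (real n ^ 2))" by (rule inverse_power_summable) auto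
  then have "summable (\<lambda>n. inverse (real (Suc n) ^ 2))" by (subst summable_Suc_iff)
  moreover have "(norm (1 / of_nat (Suc n) :: complex))\<^sup>2 = inverse (real (Suc n) ^ 2)" for n
    unfolding norm_divide norm_of_nat norm_one power_divide by (simp add: divide_inverse)
  ultimately show ?thesis by (simp add: l2_def)
qed

text \<open>Gram-Schmidt: a new vector is first made orthogonal to the earlier ones. Linear dependence is
  allowed: if the orthogonalised new vector is zero, no further correction is needed.\<close>

lemma l2_orthogonal_remainder:
  assumes "finite I" and "\<And>i. i \<in> I \<Longrightarrow> l2 (v i)" and "l2 x"
  shows "\<exists>b. \<forall>j\<in>I. (\<lambda>n. (x n - (\<Sum>i\<in>I. b i * v i n)) * cnj (v j n)) sums 0"
  using assms
proof (induction I arbitrary: x rule: finite_induct)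
  case empty
  then show ?case by simp
next
  case (insert k I)
  obtain c where c: "\<forall>j\<in>I. (\<lambda>n. (v k n - (\<Sum>i\<in>I. c i * v i n)) * cnj (v j n)) sums 0"
    using insert.IH[of "v k"] insert.prems by auto
  obtain b where b: "\<forall>j\<in>I. (\<lambda>n. (x n - (\<Sum>i\<in>I. b i * v i n)) * cnj (v j n)) sums 0"
    using insert.IH[of x] insert.prems by auto
  define w where "w = (\<lambda>n. v k n - (\<Sum>i\<in>I. c i * v i n))"
  define y where "y = (\<lambda>n. x n - (\<Sum>i\<in>I. b i * v i n))"
  have w: "l2 w" unfolding w_def using insert.prems by (intro l2_diff l2_sum l2_cmult) auto
  have y: "l2 y" unfolding y_def using insert.prems by (intro l2_diff l2_sum l2_cmult) auto
  have l2_cnj: "l2 (\<lambda>n. cnj (w n))" using w by (simp add: l2_def)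
  have ww: "(\<lambda>n. (norm (w n))\<^sup>2) sums (\<Sum>n. (norm (w n))\<^sup>2)"
    using w by (simp add: l2_def summable_sums)
  define W where "W = (\<Sum>n. (norm (w n))\<^sup>2)"
  have ww': "(\<lambda>n. w n * cnj (w n)) sums of_real W"
    using ww sums_of_real[where 'a = complex] unfolding W_def complex_norm_square[symmetric] by blast
  define Y where "Y = (\<Sum>n. y n * cnj (w n))"
  have yw: "(\<lambda>n. y n * cnj (w n)) sums Y"
    unfolding Y_def using l2_mult_summable[OF y l2_cnj]
    by (intro summable_sums) (rule summable_norm_cancel)
  have "\<exists>t. (\<lambda>n. (y n - t * w n) * cnj (w n)) sums 0"
  proof (cases "W = 0")
    case True
    then have "\<forall>n. (norm (w n))\<^sup>2 = 0"
      unfolding W_def by (subst (asm) suminf_eq_zero_iff[OF sums_summable[OF ww]]) simp_all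
    then have "w n = 0" for n by simp
    then show ?thesis by simp
  next
    case False
    have "(\<lambda>n. y n * cnj (w n) - Y / W * (w n * cnj (w n))) sums (Y - Y / W * W)"
      by (intro sums_diff sums_mult yw ww')
    then show ?thesis using False by (intro exI[of _ "Y / W"]) (simp add: algebra_simps)
  qed
  then obtain t where t: "(\<lambda>n. (y n - t * w n) * cnj (w n)) sums 0" by blast
  have orth: "(\<lambda>n. (y n - t * w n) * cnj (v j n)) sums 0" if "j \<in> I" for j
  proof -
    have "(\<lambda>n. y n * cnj (v j n) - t * (w n * cnj (v j n))) sums (0 - t * 0)"
      using b c that unfolding w_def y_def by (intro sums_diff sums_mult) auto
    then show ?thesis by (simp add: algebra_simps)
  qed
  have "(\<lambda>n. (y n - t * w n) * cnj (w n) + (\<Sum>i\<in>I. cnj (c i) * ((y n - t * w n) * cnj (v i n))))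
          sums (0 + (\<Sum>i\<in>I. cnj (c i) * 0))"
    by (intro sums_add sums_sum sums_mult t orth)
  moreover have "(y n - t * w n) * cnj (w n) + (\<Sum>i\<in>I. cnj (c i) * ((y n - t * w n) * cnj (v i n)))
      = (y n - t * w n) * cnj (v k n)" for n
  proof -
    have "cnj (v k n) = cnj (w n) + (\<Sum>i\<in>I. cnj (c i) * cnj (v i n))"
      by (simp add: w_def)
    then show ?thesis
      by (simp only: distrib_left sum_distrib_left mult.left_commute)
  qed
  ultimately have orthk: "(\<lambda>n. (y n - t * w n) * cnj (v k n)) sums 0" by simp
  define b' where "b' = (\<lambda>i. if i = k then t else b i - t * c i)"
  have "x n - (\<Sum>i\<in>insert k I. b' i * v i n) = y n - t * w n" for n
  proof -
    have "(\<Sum>i\<in>I. b' i * v i n) = (\<Sum>i\<in>I. b i * v i n) - t * (\<Sum>i\<in>I. c i * v i n)"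
      unfolding sum_distrib_left sum_subtractf[symmetric]
      using insert.hyps by (intro sum.cong) (auto simp: b'_def algebra_simps)
    then show ?thesis
      using insert.hyps by (simp add: w_def y_def b'_def algebra_simps)
  qed
  then show ?case using orth orthk by (intro exI[of _ b']) auto
qed

section \<open>Hardy's inequality\<close>

text \<open>This is the dual form of Hardy's inequality: the operator taking tails is the adjoint of the
  one taking averages. Summation by parts moves the square onto the differences of the tails;
  the truncation at \<open>M\<close> makes the boundary term vanish, and the tails that then appear on the
  right are absorbed into the left-hand side.\<close>

lemma Hardy_inequality_tails:
  fixes r :: "nat \<Rightarrow> real"
  assumes "\<And>k. r k \<ge> 0"
  shows "(\<Sum>m<M. (\<Sum>k\<in>{m<..M}. r k)\<^sup>2) \<le> 4 * (\<Sum>m<M. (real (Suc m) * r (Suc m))\<^sup>2)"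
proof -
  define t where "t = (\<lambda>m. \<Sum>k\<in>{m<..M}. r k)"
  have abel: "(\<Sum>m<N. (t m)\<^sup>2) = real N * (t N)\<^sup>2 + (\<Sum>m<N. real (Suc m) * ((t m)\<^sup>2 - (t (Suc m))\<^sup>2))" for N
    by (induction N) (auto simp: algebra_simps)
  have step: "real (Suc m) * ((t m)\<^sup>2 - (t (Suc m))\<^sup>2)
      \<le> 2 * (real (Suc m) * r (Suc m))\<^sup>2 + (t m)\<^sup>2 / 2" if "m < M" for m
  proof -
    have "{m<..M} = insert (Suc m) {Suc m<..M}" using that by auto
    then have tm: "t m = r (Suc m) + t (Suc m)" by (simp add: t_def)
    have pos: "t (Suc m) \<ge> 0" "r (Suc m) \<ge> 0" using assms by (auto simp: t_def intro: sum_nonneg)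
    define s where "s = real (Suc m) * r (Suc m)"
    have "real (Suc m) * ((t m)\<^sup>2 - (t (Suc m))\<^sup>2) = s * (t m + t (Suc m))"
      unfolding s_def tm by (simp add: power2_eq_square algebra_simps)
    also have "\<dots> \<le> s * (2 * t m)"
      using pos tm by (intro mult_left_mono) (auto simp: s_def)
    also have "\<dots> \<le> 2 * s\<^sup>2 + (t m)\<^sup>2 / 2"
      using zero_le_power2[of "2 * s - t m"] by (simp add: power2_eq_square algebra_simps)
    finally show ?thesis by (simp add: s_def)
  qed
  have "(\<Sum>m<M. (t m)\<^sup>2) = (\<Sum>m<M. real (Suc m) * ((t m)\<^sup>2 - (t (Suc m))\<^sup>2))"
    by (subst abel) (simp add: t_def)
  also have "\<dots> \<le> (\<Sum>m<M. 2 * (real (Suc m) * r (Suc m))\<^sup>2 + (t m)\<^sup>2 / 2)"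
    by (intro sum_mono step) auto
  also have "\<dots> = 2 * (\<Sum>m<M. (real (Suc m) * r (Suc m))\<^sup>2) + (\<Sum>m<M. (t m)\<^sup>2) / 2"
    by (simp add: sum.distrib sum_distrib_left sum_divide_distrib)
  finally show ?thesis by (simp add: t_def)
qed

text \<open>When the total is zero, a partial sum is minus a tail, so Hardy's inequality applies. It is used
  for the finite differences between partial sums, followed by a limit.\<close>

lemma l2_partial_sums:
  fixes r :: "nat \<Rightarrow> complex"
  assumes r: "l2 (\<lambda>n. of_nat (Suc n) * r n)" and sums: "r sums 0"
  shows "l2 (\<lambda>m. \<Sum>k\<le>m. r k)"
proof -
  define q where "q = (\<lambda>m. \<Sum>k\<le>m. r k)"
  define S where "S = (\<Sum>n. (norm (of_nat (Suc n) * r n))\<^sup>2)"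
  have bound: "(\<Sum>m<N. (norm (q m - q M))\<^sup>2) \<le> 4 * S" if "N \<le> M" for N M
  proof -
    have "norm (q m - q M) \<le> (\<Sum>k\<in>{m<..M}. norm (r k))" if "m < M" for m
    proof -
      have "{..M} = {..m} \<union> {m<..M}" using that by auto
      then have "q M = q m + (\<Sum>k\<in>{m<..M}. r k)"
        unfolding q_def by (simp only:, subst sum.union_disjoint) auto
      then show ?thesis by (simp add: norm_sum)
    qed
    then have "(\<Sum>m<N. (norm (q m - q M))\<^sup>2) \<le> (\<Sum>m<N. (\<Sum>k\<in>{m<..M}. norm (r k))\<^sup>2)"
      using that by (intro sum_mono power_mono) auto
    also have "\<dots> \<le> (\<Sum>m<M. (\<Sum>k\<in>{m<..M}. norm (r k))\<^sup>2)"
      using that by (intro sum_mono2) auto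
    also have "\<dots> \<le> 4 * (\<Sum>m<M. (real (Suc m) * norm (r (Suc m)))\<^sup>2)"
      by (rule Hardy_inequality_tails) auto
    also have "(\<Sum>m<M. (real (Suc m) * norm (r (Suc m)))\<^sup>2)
        \<le> (\<Sum>m<M. (norm (of_nat (Suc (Suc m)) * r (Suc m)))\<^sup>2)"
      unfolding norm_mult norm_of_nat by (intro sum_mono power_mono mult_right_mono) auto
    also have "\<dots> = (\<Sum>n\<in>{Suc 0..M}. (norm (of_nat (Suc n) * r n))\<^sup>2)"
      by (simp add: sum.atLeast1_atMost_eq)
    also have "\<dots> \<le> S"
      unfolding S_def using r by (intro sum_le_suminf) (auto simp: l2_def)
    finally show ?thesis by simp
  qed
  have "q \<longlonglongrightarrow> 0" using sums unfolding q_def sums_def_le .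
  then have lim: "(\<lambda>M. \<Sum>m<N. (norm (q m - q M))\<^sup>2) \<longlonglongrightarrow> (\<Sum>m<N. (norm (q m - 0))\<^sup>2)" for N
    by (intro tendsto_intros)
  have "(\<Sum>m<N. (norm (q m))\<^sup>2) \<le> 4 * S" for N
    using LIMSEQ_le_const2[OF lim[of N], of "4 * S"] bound by auto
  then have "summable (\<lambda>m. (norm (q m))\<^sup>2)"
    by (intro bounded_imp_summable[of _ "4 * S"])
       (auto simp: lessThan_Suc_atMost[symmetric] simp del: sum.lessThan_Suc)
  then show ?thesis by (simp add: l2_def q_def)
qed

section \<open>Power series with square-summable coefficients\<close>

definition l2_series :: "(complex \<Rightarrow> complex) \<Rightarrow> bool" where
  "l2_series f \<longleftrightarrow> (\<exists>c. l2 c \<and> (\<forall>z\<in>ball 0 1. (\<lambda>n. c n * z ^ n) sums f z))"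

lemma l2_power_series_summable:
  assumes "l2 c" "norm z < 1" shows "summable (\<lambda>n. c n * z ^ n)"
  using l2_mult_summable[OF assms(1) l2_power[OF assms(2)]] by (rule summable_norm_cancel)

lemma l2_series_suminf: "l2 c \<Longrightarrow> l2_series (\<lambda>z. \<Sum>n. c n * z ^ n)"
  unfolding l2_series_def
  by (intro exI[of _ c]) (auto intro: summable_sums[OF l2_power_series_summable])

lemma l2_series_add:
  assumes "l2_series f" "l2_series g" shows "l2_series (\<lambda>z. f z + g z)"
proof -
  obtain c d where "l2 c" "l2 d" "\<forall>z\<in>ball 0 1. (\<lambda>n. c n * z ^ n) sums f z"
    "\<forall>z\<in>ball 0 1. (\<lambda>n. d n * z ^ n) sums g z"
    using assms by (auto simp: l2_series_def)
  then show ?thesis unfolding l2_series_def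
    by (intro exI[of _ "\<lambda>n. c n + d n"]) (auto intro: l2_add sums_add simp: distrib_right)
qed

lemma l2_series_cmult:
  assumes "l2_series f" shows "l2_series (\<lambda>z. c * f z)"
proof -
  obtain d where "l2 d" "\<forall>z\<in>ball 0 1. (\<lambda>n. d n * z ^ n) sums f z"
    using assms by (auto simp: l2_series_def)
  then show ?thesis unfolding l2_series_def
    by (intro exI[of _ "\<lambda>n. c * d n"]) (auto intro: l2_cmult sums_mult simp: mult.assoc)
qed

lemma l2_series_sum:
  "(\<And>i. i \<in> I \<Longrightarrow> l2_series (f i)) \<Longrightarrow> l2_series (\<lambda>z. \<Sum>i\<in>I. f i z)"
proof (induction I rule: infinite_finite_induct)
  case (insert i I)
  then show ?case by (simp add: l2_series_add)
qed (auto simp: l2_series_def l2_def intro!: exI[of _ "\<lambda>_. 0"])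

text \<open>The next lemmas show that such functions lie in \<open>hardy2\<close>: on a circle of radius \<open>r < 1\<close> the
  partial sums converge uniformly, and the mean square of each of them is, by orthogonality of the
  exponentials, at most the sum of the squared moduli of the coefficients.\<close>

lemma has_integral_cis_multiple:
  fixes k :: int
  shows "((\<lambda>t. cis (k * t)) has_integral (if k = 0 then 2 * pi else 0)) {0..2 * pi}"
proof (cases "k = 0")
  case True
  then show ?thesis using has_integral_const_real[of "1::complex" 0 "2 * pi"] by (simp add: scaleR_conv_of_real)
next
  case False
  define G where "G = (\<lambda>t::real. cis (k * t) / (\<i> * of_int k))"
  have "((\<lambda>t. cis (k * t)) has_integral (G (2 * pi) - G 0)) {0..2 * pi}"
  proof (rule fundamental_theorem_of_calculus)
    fix t :: real assume "t \<in> {0..2 * pi}"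
    have "((\<lambda>z. exp (\<i> * of_int k * z) / (\<i> * of_int k)) has_field_derivative exp (\<i> * of_int k * of_real t)) (at (of_real t))"
      using False by (auto intro!: derivative_eq_intros)
    then show "(G has_vector_derivative cis (k * t)) (at t within {0..2 * pi})"
      unfolding G_def cis_conv_exp
      by (auto dest!: has_vector_derivative_real_field simp: mult_ac)
  qed auto
  moreover have "G (2 * pi) = G 0"
    using cis_multiple_2pi[of "of_int k"] by (simp add: G_def mult.commute mult.left_commute)
  ultimately show ?thesis using False by simp
qed

lemma Parseval_trigonometric_polynomial:
  fixes c :: "nat \<Rightarrow> complex"
  shows "((\<lambda>t. (norm (\<Sum>n<N. c n * cis t ^ n))\<^sup>2) has_integral 2 * pi * (\<Sum>n<N. (norm (c n))\<^sup>2)) {0..2 * pi}"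
proof -
  have expand: "complex_of_real ((norm (\<Sum>n<N. c n * cis t ^ n))\<^sup>2)
     = (\<Sum>m<N. \<Sum>n<N. (c m * cnj (c n)) * cis (of_int (int m - int n) * t))" for t
  proof -
    have "c m * cis t ^ m * cnj (c n * cis t ^ n) = (c m * cnj (c n)) * cis (of_int (int m - int n) * t)" for m n
      by (simp add: Complex.DeMoivre cis_cnj cis_mult algebra_simps)
    then show ?thesis
      unfolding complex_norm_square cnj_sum sum_product by (simp only:)
  qed
  have "((\<lambda>t. \<Sum>m<N. \<Sum>n<N. (c m * cnj (c n)) * cis (of_int (int m - int n) * t)) has_integral
      (\<Sum>m<N. \<Sum>n<N. (c m * cnj (c n)) * (if int m - int n = 0 then 2 * pi else 0))) {0..2 * pi}"
    by (intro has_integral_sum has_integral_mult_right has_integral_cis_multiple) auto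
  also have "(\<Sum>m<N. \<Sum>n<N. (c m * cnj (c n)) * complex_of_real (if int m - int n = 0 then 2 * pi else 0))
      = (\<Sum>m<N. c m * cnj (c m) * (2 * pi))"
  proof (intro sum.cong refl)
    fix m assume "m \<in> {..<N}"
    have "(\<Sum>n<N. (c m * cnj (c n)) * complex_of_real (if int m - int n = 0 then 2 * pi else 0))
      = (\<Sum>n<N. if m = n then c m * cnj (c n) * (2 * pi) else 0)"
      by (intro sum.cong) auto
    then show "(\<Sum>n<N. (c m * cnj (c n)) * complex_of_real (if int m - int n = 0 then 2 * pi else 0))
      = c m * cnj (c m) * (2 * pi)"
      using \<open>m \<in> {..<N}\<close> by simp
  qed
  also have "\<dots> = complex_of_real (2 * pi * (\<Sum>n<N. (norm (c n))\<^sup>2))"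
    unfolding of_real_mult of_real_sum complex_norm_square sum_distrib_left by (simp add: mult_ac)
  finally show ?thesis
    unfolding expand[symmetric] by (drule_tac has_integral_Re) simp
qed

lemma l2_series_imp_hardy2:
  assumes "l2_series g" shows "g \<in> hardy2"
proof -
  obtain c where c: "l2 c" and g: "\<And>z. z \<in> ball 0 1 \<Longrightarrow> (\<lambda>n. c n * z ^ n) sums g z"
    using assms by (auto simp: l2_series_def)
  have holo: "g holomorphic_on ball 0 1"
    by (rule power_series_holomorphic[where a = c]) (use g in simp)
  have "1 / (2 * pi) * integral {0..2 * pi} (\<lambda>t. (norm (g (of_real r * cis t)))\<^sup>2)
      \<le> (\<Sum>n. (norm (c n))\<^sup>2)" if r: "r \<in> {0<..<1}" for r :: real
  proof -
    define u where "u = (\<lambda>N t. \<Sum>n<N. c n * of_real r ^ n * cis t ^ n)"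
    have un: "uniform_limit {0..2 * pi} u (\<lambda>t. g (of_real r * cis t)) sequentially"
    proof -
      have "uniform_limit {0..2 * pi} u (\<lambda>t. \<Sum>n. c n * of_real r ^ n * cis t ^ n) sequentially"
        unfolding u_def
      proof (rule Weierstrass_m_test)
        show "norm (c n * of_real r ^ n * cis t ^ n) \<le> norm (c n * of_real r ^ n)" for n t
          by (simp add: norm_mult norm_power)
        show "summable (\<lambda>n. norm (c n * of_real r ^ n))"
          using r by (intro l2_mult_summable c l2_power) auto
      qed
      moreover have "(\<Sum>n. c n * of_real r ^ n * cis t ^ n) = g (of_real r * cis t)" for t
        using sums_unique[OF g[of "of_real r * cis t"]] r
        by (simp add: norm_mult power_mult_distrib mult.assoc)
      ultimately show ?thesis by simp
    qed
    have contu: "continuous_on {0..2 * pi} (u N)" for N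
      unfolding u_def by (intro continuous_intros)
    have contg: "continuous_on {0..2 * pi} (\<lambda>t. g (of_real r * cis t))"
      by (rule uniform_limit_theorem[OF _ un]) (auto simp: contu)
    have bnd: "bounded ((\<lambda>t. norm (g (of_real r * cis t))) ` {0..2 * pi})"
      by (intro compact_imp_bounded compact_continuous_image continuous_on_norm contg) auto
    have un2: "uniform_limit {0..2 * pi} (\<lambda>N t. (norm (u N t))\<^sup>2)
        (\<lambda>t. (norm (g (of_real r * cis t)))\<^sup>2) sequentially"
      unfolding power2_eq_square
      by (intro uniform_lim_mult uniform_limit_intros un bnd)
    have cont2: "continuous_on {0..2 * pi} (\<lambda>t. (norm (u N t))\<^sup>2)" for N
      by (intro continuous_intros contu)
    have lim: "(\<lambda>N. integral {0..2 * pi} (\<lambda>t. (norm (u N t))\<^sup>2))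
        \<longlonglongrightarrow> integral {0..2 * pi} (\<lambda>t. (norm (g (of_real r * cis t)))\<^sup>2)"
    proof -
      obtain I L where IL:
        "\<And>N. ((\<lambda>t. (norm (u N t))\<^sup>2) has_integral I N) {0..2 * pi}"
        "((\<lambda>t. (norm (g (of_real r * cis t)))\<^sup>2) has_integral L) {0..2 * pi}" "I \<longlonglongrightarrow> L"
        using uniform_limit_integral[OF un2 cont2] by auto
      show ?thesis using IL(3) by (simp add: integral_unique[OF IL(1)] integral_unique[OF IL(2)])
    qed
    have "integral {0..2 * pi} (\<lambda>t. (norm (u N t))\<^sup>2) \<le> 2 * pi * (\<Sum>n. (norm (c n))\<^sup>2)" for N
    proof -
      have "integral {0..2 * pi} (\<lambda>t. (norm (u N t))\<^sup>2) = 2 * pi * (\<Sum>n<N. (norm (c n * of_real r ^ n))\<^sup>2)"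
        unfolding u_def by (intro integral_unique Parseval_trigonometric_polynomial)
      also have "(\<Sum>n<N. (norm (c n * of_real r ^ n))\<^sup>2) \<le> (\<Sum>n<N. (norm (c n))\<^sup>2)"
        using r by (intro sum_mono power_mono) (auto simp: norm_mult norm_power mult_left_le power_le_one)
      also have "\<dots> \<le> (\<Sum>n. (norm (c n))\<^sup>2)"
        using c by (intro sum_le_suminf) (auto simp: l2_def)
      finally show ?thesis by simp
    qed
    then have "integral {0..2 * pi} (\<lambda>t. (norm (g (of_real r * cis t)))\<^sup>2) \<le> 2 * pi * (\<Sum>n. (norm (c n))\<^sup>2)"
      by (intro LIMSEQ_le_const2[OF lim]) auto
    then show ?thesis by (simp add: field_simps)
  qed
  then have "bdd_above ((\<lambda>r. 1 / (2 * pi) * integral {0..2 * pi} (\<lambda>t. (norm (g (of_real r * cis t)))\<^sup>2)) ` {0<..<1})"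
    by (rule bdd_aboveI2)
  with holo show ?thesis by (simp add: hardy2_def)
qed

section \<open>Dividing out boundary zeros\<close>

text \<open>These are the functions whose derivative is in the Hardy space, as explicit series. The
  weight makes the coefficients absolutely summable, so the sum is determined on the closed disc,
  which is where boundary zeros are evaluated.\<close>

definition sobolev_series :: "(complex \<Rightarrow> complex) \<Rightarrow> bool" where
  "sobolev_series R \<longleftrightarrow> (\<exists>r. l2 (\<lambda>n. of_nat (Suc n) * r n) \<and>
     (\<forall>z\<in>cball 0 1. (\<lambda>n. r n * z ^ n) sums R z))"

lemma sobolev_coeffs_summable:
  assumes "l2 (\<lambda>n. of_nat (Suc n) * r n)" "norm z \<le> 1"
  shows "summable (\<lambda>n. r n * z ^ n)"
proof (rule summable_comparison_test)
  have "summable (\<lambda>n. norm ((of_nat (Suc n) * r n) * (1 / of_nat (Suc n))))"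
    by (rule l2_mult_summable[OF assms(1) l2_inverse])
  then show "summable (\<lambda>n. norm (r n))" by (simp del: of_nat_Suc)
  have "norm (r n * z ^ n) \<le> norm (r n)" for n
    using assms(2) by (simp add: norm_mult norm_power mult_left_le power_le_one)
  then show "\<exists>N. \<forall>n\<ge>N. norm (r n * z ^ n) \<le> norm (r n)" by blast
qed

lemma sobolev_series_suminf:
  "l2 (\<lambda>n. of_nat (Suc n) * r n) \<Longrightarrow> sobolev_series (\<lambda>z. \<Sum>n. r n * z ^ n)"
  unfolding sobolev_series_def
  by (intro exI[of _ r] conjI ballI summable_sums sobolev_coeffs_summable) auto

lemma sobolev_series_add:
  assumes "sobolev_series f" "sobolev_series g" shows "sobolev_series (\<lambda>z. f z + g z)"
proof -
  obtain c d where cd: "l2 (\<lambda>n. of_nat (Suc n) * c n)" "l2 (\<lambda>n. of_nat (Suc n) * d n)"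
    "\<forall>z\<in>cball 0 1. (\<lambda>n. c n * z ^ n) sums f z" "\<forall>z\<in>cball 0 1. (\<lambda>n. d n * z ^ n) sums g z"
    using assms unfolding sobolev_series_def by blast
  have "l2 (\<lambda>n. of_nat (Suc n) * (c n + d n))"
    using l2_add[OF cd(1,2)] by (simp only: distrib_left)
  then show ?thesis unfolding sobolev_series_def using cd(3,4)
    by (intro exI[of _ "\<lambda>n. c n + d n"]) (auto intro: sums_add simp: distrib_right)
qed

lemma sobolev_series_cmult:
  assumes "sobolev_series f" shows "sobolev_series (\<lambda>z. c * f z)"
proof -
  obtain d where d: "l2 (\<lambda>n. of_nat (Suc n) * d n)" "\<forall>z\<in>cball 0 1. (\<lambda>n. d n * z ^ n) sums f z"
    using assms unfolding sobolev_series_def by blast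
  have "l2 (\<lambda>n. of_nat (Suc n) * (c * d n))"
    using l2_cmult[OF d(1), of c] by (simp only: mult.left_commute)
  then show ?thesis unfolding sobolev_series_def using d(2)
    by (intro exI[of _ "\<lambda>n. c * d n"]) (auto intro: sums_mult simp: mult.assoc)
qed

lemma sobolev_series_sum:
  "(\<And>i. i \<in> I \<Longrightarrow> sobolev_series (f i)) \<Longrightarrow> sobolev_series (\<lambda>z. \<Sum>i\<in>I. f i z)"
proof (induction I rule: infinite_finite_induct)
  case (insert i I)
  then show ?case by (simp add: sobolev_series_add)
qed (auto simp: sobolev_series_def l2_def intro!: exI[of _ "\<lambda>_. 0"])

lemma sobolev_series_mult_ident:
  assumes "sobolev_series f" shows "sobolev_series (\<lambda>z. z * f z)"
proof -
  obtain d where d: "l2 (\<lambda>n. of_nat (Suc n) * d n)" "\<forall>z\<in>cball 0 1. (\<lambda>n. d n * z ^ n) sums f z"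
    using assms unfolding sobolev_series_def by blast
  define e where "e = (\<lambda>n. case n of 0 \<Rightarrow> 0 | Suc m \<Rightarrow> d m)"
  have "l2 (\<lambda>n. of_nat (Suc (Suc n)) * e (Suc n))"
  proof (rule l2_dominated[OF d(1)])
    fix n
    have "norm (of_nat (Suc (Suc n)) * e (Suc n)) = real (Suc (Suc n)) * norm (d n)"
      unfolding norm_mult norm_of_nat by (simp add: e_def)
    also have "\<dots> \<le> (2 * real (Suc n)) * norm (d n)"
      by (intro mult_right_mono) auto
    finally show "norm (of_nat (Suc (Suc n)) * e (Suc n)) \<le> 2 * norm (of_nat (Suc n) * d n)"
      unfolding norm_mult norm_of_nat by (simp only: mult.assoc)
  qed
  then have "l2 (\<lambda>n. of_nat (Suc n) * e n)"
    unfolding l2_def by (subst (asm) summable_Suc_iff)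
  moreover have "(\<lambda>n. e n * z ^ n) sums (z * f z)" if "z \<in> cball 0 1" for z
  proof -
    have "(\<lambda>n. z * (d n * z ^ n)) sums (z * f z)" using d(2) that by (intro sums_mult) auto
    then have "(\<lambda>n. e (Suc n) * z ^ Suc n) sums (z * f z)" by (simp add: e_def mult_ac)
    from sums_Suc[OF this] show ?thesis by (simp add: e_def)
  qed
  ultimately show ?thesis unfolding sobolev_series_def by blast
qed

lemma sobolev_series_mult_power: "sobolev_series f \<Longrightarrow> sobolev_series (\<lambda>z. z ^ k * f z)"
  by (induction k) (auto simp: mult.assoc intro: sobolev_series_mult_ident)

lemma boundary_factor_nonzero:
  assumes "norm \<zeta> = 1" "norm z < 1" shows "1 - cnj \<zeta> * z \<noteq> 0"
proof
  assume "1 - cnj \<zeta> * z = 0"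
  then have "norm (cnj \<zeta> * z) = 1" by simp
  then show False using assms by (simp add: norm_mult)
qed

text \<open>The coefficients of the quotient are, up to unimodular factors, the partial sums of the
  series of \<open>R\<close> at \<open>\<zeta>\<close>. As that series has sum \<open>0\<close>, Hardy's inequality makes them
  square-summable.\<close>

lemma l2_series_divide_boundary_zero:
  assumes R: "sobolev_series R" and "norm \<zeta> = 1" and "R \<zeta> = 0"
  shows "l2_series (\<lambda>z. R z / (1 - cnj \<zeta> * z))"
proof -
  obtain r where r: "l2 (\<lambda>n. of_nat (Suc n) * r n)"
    and sums: "\<And>z. norm z \<le> 1 \<Longrightarrow> (\<lambda>n. r n * z ^ n) sums R z"
    using R unfolding sobolev_series_def by auto
  have unit: "cnj \<zeta> ^ n * \<zeta> ^ n = 1" for n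
    using assms(2) by (simp add: power_mult_distrib[symmetric] mult.commute complex_norm_square[symmetric])
  define q where "q = (\<lambda>m. cnj \<zeta> ^ m * (\<Sum>k\<le>m. r k * \<zeta> ^ k))"
  have "l2 (\<lambda>m. \<Sum>k\<le>m. r k * \<zeta> ^ k)"
  proof (rule l2_partial_sums)
    show "l2 (\<lambda>n. of_nat (Suc n) * (r n * \<zeta> ^ n))"
      by (rule l2_dominated[OF r, of _ 1]) (simp add: norm_mult norm_power assms(2) del: of_nat_Suc)
    show "(\<lambda>n. r n * \<zeta> ^ n) sums 0" using sums[of \<zeta>] assms by simp
  qed
  then have q: "l2 q"
    by (rule l2_dominated[of _ _ 1]) (simp add: q_def norm_mult norm_power assms(2))
  have rec: "q (Suc m) = cnj \<zeta> * q m + r (Suc m)" for m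
    using unit[of "Suc m"] by (simp add: q_def algebra_simps)
  have "(\<lambda>n. q n * z ^ n) sums (R z / (1 - cnj \<zeta> * z))" if z: "norm z < 1" for z
  proof -
    define Q where "Q = (\<Sum>n. q n * z ^ n)"
    have Q: "(\<lambda>n. q n * z ^ n) sums Q"
      unfolding Q_def by (intro summable_sums l2_power_series_summable q z)
    have "(\<lambda>n. q (Suc n) * z ^ Suc n) sums (Q - q 0)"
      using Q by (subst sums_Suc_iff) simp
    then have "(\<lambda>n. q (Suc n) * z ^ Suc n - (cnj \<zeta> * z) * (q n * z ^ n)) sums (Q - q 0 - (cnj \<zeta> * z) * Q)"
      by (intro sums_diff sums_mult Q)
    moreover have "q (Suc n) * z ^ Suc n - (cnj \<zeta> * z) * (q n * z ^ n) = r (Suc n) * z ^ Suc n" for n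
      by (simp add: rec algebra_simps)
    ultimately have "(\<lambda>n. r (Suc n) * z ^ Suc n) sums (Q - q 0 - (cnj \<zeta> * z) * Q)" by (simp only:)
    then have "(\<lambda>n. r n * z ^ n) sums (Q - q 0 - (cnj \<zeta> * z) * Q + r 0)"
      using sums_Suc[of "\<lambda>n. r n * z ^ n"] by simp
    then have "R z = Q * (1 - cnj \<zeta> * z)"
      using sums_unique2[OF sums[of z]] z by (simp add: q_def algebra_simps)
    moreover have "1 - cnj \<zeta> * z \<noteq> 0" by (rule boundary_factor_nonzero[OF assms(2) z])
    ultimately show ?thesis using Q by simp
  qed
  then show ?thesis using q unfolding l2_series_def by (intro exI[of _ q]) auto
qed

text \<open>By induction on the number of factors, from
  \<open>(w - w') / ((1 - w * z) * (1 - w' * z)) = w / (1 - w * z) - w' / (1 - w' * z)\<close>.\<close>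

lemma partial_fractions_linear_factors:
  fixes w :: "'i \<Rightarrow> 'a :: field"
  assumes "finite I" "I \<noteq> {}" "inj_on w I"
  shows "\<exists>A. \<forall>z. (\<forall>i\<in>I. 1 - w i * z \<noteq> 0) \<longrightarrow> 1 / (\<Prod>i\<in>I. 1 - w i * z) = (\<Sum>i\<in>I. A i / (1 - w i * z))"
  using assms
proof (induction I rule: finite_ne_induct)
  case (singleton i)
  show ?case by (intro exI[of _ "\<lambda>_. 1"]) simp
next
  case (insert k I)
  then obtain A where A: "\<And>z. (\<forall>i\<in>I. 1 - w i * z \<noteq> 0) \<Longrightarrow>
      1 / (\<Prod>i\<in>I. 1 - w i * z) = (\<Sum>i\<in>I. A i / (1 - w i * z))" by auto
  have ne: "w i - w k \<noteq> 0" if "i \<in> I" for i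
    using insert.prems insert.hyps that by (auto simp: inj_on_def)
  (* the coefficient of the new factor collects what each old term splits off *)
  define A' where "A' = (\<lambda>i. if i = k then - (\<Sum>i\<in>I. A i * w k / (w i - w k)) else A i * w i / (w i - w k))"
  have "1 / (\<Prod>i\<in>insert k I. 1 - w i * z) = (\<Sum>i\<in>insert k I. A' i / (1 - w i * z))"
    if z: "\<forall>i\<in>insert k I. 1 - w i * z \<noteq> 0" for z
  proof -
    have two: "A i / (1 - w i * z) / (1 - w k * z)
        = A i * w i / (w i - w k) / (1 - w i * z) - A i * w k / (w i - w k) / (1 - w k * z)"
      if "i \<in> I" for i
    proof -
      define u v d where "u = 1 - w i * z" and "v = 1 - w k * z" and "d = w i - w k"
      have nz: "u \<noteq> 0" "v \<noteq> 0" "d \<noteq> 0"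
        using z that ne[OF that] by (auto simp: u_def v_def d_def)
      have "A i * w i / d / u - A i * w k / d / v = A i * (w i * v - w k * u) / (d * u * v)"
        using nz by (simp add: field_simps)
      also have "w i * v - w k * u = d" by (simp add: u_def v_def d_def algebra_simps)
      also have "A i * d / (d * u * v) = A i / u / v" using nz by simp
      finally show ?thesis by (simp add: u_def v_def d_def)
    qed
    have "1 / (\<Prod>i\<in>insert k I. 1 - w i * z) = (1 / (\<Prod>i\<in>I. 1 - w i * z)) / (1 - w k * z)"
      using insert.hyps by simp
    also have "\<dots> = (\<Sum>i\<in>I. A i / (1 - w i * z) / (1 - w k * z))"
      using A[of z] z by (simp add: sum_divide_distrib)
    also have "\<dots> = (\<Sum>i\<in>I. A' i / (1 - w i * z)) + A' k / (1 - w k * z)"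
    proof -
      have "(\<Sum>i\<in>I. A' i / (1 - w i * z)) = (\<Sum>i\<in>I. A i * w i / (w i - w k) / (1 - w i * z))"
        using insert.hyps by (intro sum.cong) (auto simp: A'_def)
      then show ?thesis
        using sum.cong[OF refl two, of I] by (simp add: A'_def sum_subtractf sum_divide_distrib)
    qed
    finally show ?thesis using insert.hyps by simp
  qed
  then show ?case by blast
qed

section \<open>Perturbing the argument of a polynomial\<close>

lemma convergent_scaled_power_difference:
  fixes a :: "nat \<Rightarrow> complex"
  assumes "a \<longlonglongrightarrow> 1" and "convergent (\<lambda>n. of_nat (Suc n) * (a n - 1))"
  shows "convergent (\<lambda>n. of_nat (Suc n) * (a n ^ k - 1))"
proof (induction k)
  case 0
  then show ?case by (simp add: convergent_const)
next
  case (Suc k)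
  have "convergent a" using assms(1) by (auto simp: convergent_def)
  then have "convergent (\<lambda>n. a n * (of_nat (Suc n) * (a n ^ k - 1)) + of_nat (Suc n) * (a n - 1))"
    by (intro convergent_add convergent_mult Suc assms(2))
  then show ?case by (simp add: algebra_simps)
qed

text \<open>The factor \<open>a n ^ k - 1 = O(1/n)\<close> that the perturbation produces in front of \<open>z ^ k\<close> turns
  square-summable coefficients into coefficients with the extra weight.\<close>

lemma sobolev_series_perturbed_polynomial:
  fixes a \<beta> :: "nat \<Rightarrow> complex"
  assumes a: "a \<longlonglongrightarrow> 1" "convergent (\<lambda>n. of_nat (Suc n) * (a n - 1))" and \<beta>: "l2 \<beta>"
  shows "\<exists>R. sobolev_series R \<and>
    (\<forall>z\<in>cball 0 1. (\<lambda>n. \<beta> n * (z ^ n * (poly P (a n * z) - poly P z))) sums R z)"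
proof -
  have coeffs: "l2 (\<lambda>n. of_nat (Suc n) * (\<beta> n * (a n ^ k - 1)))" for k
    using l2_mult_Bseq[OF convergent_imp_Bseq[OF convergent_scaled_power_difference[OF a]] \<beta>]
    by (simp only: mult_ac)
  define D where "D = (\<lambda>k z. \<Sum>n. \<beta> n * (a n ^ k - 1) * z ^ n)"
  define R where "R = (\<lambda>z. \<Sum>k\<le>degree P. coeff P k * (z ^ k * D k z))"
  have "sobolev_series R"
    unfolding R_def D_def
    by (intro sobolev_series_sum sobolev_series_cmult sobolev_series_mult_power
        sobolev_series_suminf coeffs)
  moreover have "(\<lambda>n. \<beta> n * (z ^ n * (poly P (a n * z) - poly P z))) sums R z" if "norm z \<le> 1" for z
  proof -
    have "(\<lambda>n. \<Sum>k\<le>degree P. coeff P k * (z ^ k * (\<beta> n * (a n ^ k - 1) * z ^ n))) sums R z"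
      unfolding R_def D_def
      by (intro sums_sum sums_mult summable_sums sobolev_coeffs_summable coeffs that)
    moreover have "(\<Sum>k\<le>degree P. coeff P k * (z ^ k * (\<beta> n * (a n ^ k - 1) * z ^ n)))
        = \<beta> n * (z ^ n * (poly P (a n * z) - poly P z))" for n
      unfolding poly_altdef sum_subtractf[symmetric] sum_distrib_left
      by (intro sum.cong) (auto simp: algebra_simps)
    ultimately show ?thesis by simp
  qed
  ultimately show ?thesis by (intro exI[of _ R]) auto
qed

lemma l2_perturbed_root:
  fixes a :: "nat \<Rightarrow> complex"
  assumes a: "a \<longlonglongrightarrow> 1" "convergent (\<lambda>n. of_nat (Suc n) * (a n - 1))" and "poly P z = 0"
  shows "l2 (\<lambda>n. poly P (a n * z))"
proof -
  have "convergent (\<lambda>n. \<Sum>k\<le>degree P. coeff P k * z ^ k * (of_nat (Suc n) * (a n ^ k - 1)))"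
    by (intro convergent_sum convergent_mult convergent_const convergent_scaled_power_difference a)
  also have "(\<lambda>n. \<Sum>k\<le>degree P. coeff P k * z ^ k * (of_nat (Suc n) * (a n ^ k - 1)))
      = (\<lambda>n. of_nat (Suc n) * (poly P (a n * z) - poly P z))"
    unfolding poly_altdef sum_subtractf[symmetric] sum_distrib_left
    by (intro ext sum.cong) (auto simp: algebra_simps)
  finally have "Bseq (\<lambda>n. of_nat (Suc n) * poly P (a n * z))"
    using assms(3) by (intro convergent_imp_Bseq) simp
  from l2_mult_Bseq[OF this l2_inverse] show ?thesis by (simp del: of_nat_Suc)
qed

lemma tendsto_of_scaled_tendsto:
  fixes a :: "nat \<Rightarrow> complex"
  assumes lim: "(\<lambda>n. of_nat n * (1 - a n)) \<longlonglongrightarrow> p"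
  shows "a \<longlonglongrightarrow> 1" and "convergent (\<lambda>n. of_nat (Suc n) * (a n - 1))"
proof -
  have "(\<lambda>n. of_nat n * (1 - a n) * (1 / of_nat n)) \<longlonglongrightarrow> p * 0"
    by (intro tendsto_mult lim lim_1_over_n)
  moreover have "\<forall>\<^sub>F n in sequentially. of_nat n * (1 - a n) * (1 / of_nat n) = 1 - a n"
    by (rule eventually_sequentiallyI[of 1]) simp
  ultimately have "(\<lambda>n. 1 - a n) \<longlonglongrightarrow> p * 0"
    by (rule Lim_transform_eventually)
  then have "(\<lambda>n. 1 - (1 - a n)) \<longlonglongrightarrow> 1 - p * 0" by (intro tendsto_intros)
  then show a: "a \<longlonglongrightarrow> 1" by simp
  have "(\<lambda>n. (a n - 1) - of_nat n * (1 - a n)) \<longlonglongrightarrow> (1 - 1) - p"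
    by (intro tendsto_intros a lim)
  then show "convergent (\<lambda>n. of_nat (Suc n) * (a n - 1))"
    unfolding convergent_def by (intro exI[of _ "(1 - 1) - p"]) (simp add: algebra_simps)
qed

section \<open>The decomposition\<close>

theorem theorem12:
  fixes J :: nat and \<zeta> a :: "nat \<Rightarrow> complex" and p :: real and F :: "complex \<Rightarrow> complex"
  assumes "J \<ge> 1"
    and "\<And>j. j \<in> {1..J} \<Longrightarrow> norm (\<zeta> j) = 1"
    and "inj_on \<zeta> {1..J}"
    and "\<And>n. a n \<noteq> 1"
    and "(\<lambda>n. of_nat n * (1 - a n)) \<longlonglongrightarrow> complex_of_real p"
    and "p > 0"
    and "F \<in> rkhs_on (ball 0 1 \<union> \<zeta> ` {1..J}) (basis_fun J \<zeta> a)"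
  shows "\<exists>g \<in> hardy2. \<exists>b :: nat \<Rightarrow> complex. \<forall>z \<in> ball 0 1.
           F z = phi J \<zeta> z * g z + (\<Sum>j=1..J. b j * kernel_of (basis_fun J \<zeta> a) z (\<zeta> j))"
proof -
  note a = tendsto_of_scaled_tendsto[OF assms(5)]
  obtain \<alpha> where \<alpha>: "l2 \<alpha>"
    and F: "\<And>z. z \<in> ball 0 1 \<union> \<zeta> ` {1..J} \<Longrightarrow> (\<lambda>n. \<alpha> n * basis_fun J \<zeta> a n z) sums F z"
    using assms(7) unfolding rkhs_on_def l2_def by blast
  define P where "P = (\<Prod>j=1..J. [:1, - cnj (\<zeta> j):])"
  have phi: "phi J \<zeta> z = poly P z" for z
    by (simp add: phi_def P_def poly_prod mult.commute)
  define f where "f = basis_fun J \<zeta> a"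
  have f: "f n z = z ^ n * poly P (a n * z)" for n z
    by (simp add: f_def basis_fun_def phi)
  have root: "poly P (\<zeta> j) = 0" if "j \<in> {1..J}" for j
    using that assms(2)[OF that]
    by (auto simp: P_def poly_prod mult.commute complex_norm_square[symmetric] intro!: bexI[of _ j])
  have l2_disc: "l2 (\<lambda>n. f n z)" if "norm z < 1" for z
  proof -
    have "(\<lambda>n. poly P (a n * z)) \<longlonglongrightarrow> poly P (1 * z)"
      by (intro tendsto_intros a)
    then have "Bseq (\<lambda>n. poly P (a n * z))"
      by (intro convergent_imp_Bseq) (auto simp: convergent_def)
    from l2_mult_Bseq[OF this l2_power[OF that]] show ?thesis by (simp add: f mult.commute)
  qed
  (* v j is the coefficient sequence of the kernel function at the point \<zeta> j *)
  define v where "v = (\<lambda>j n. cnj (f n (\<zeta> j)))"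
  have v: "l2 (v j)" if "j \<in> {1..J}" for j
    by (rule l2_dominated[OF l2_perturbed_root[OF a root[OF that]], of _ 1])
       (use assms(2)[OF that] in \<open>simp add: v_def f norm_mult norm_power\<close>)
  obtain b where b: "\<And>j. j \<in> {1..J} \<Longrightarrow> (\<lambda>n. (\<alpha> n - (\<Sum>i=1..J. b i * v i n)) * cnj (v j n)) sums 0"
    using l2_orthogonal_remainder[of "{1..J}" v \<alpha>] v \<alpha> by blast
  define \<beta> where "\<beta> = (\<lambda>n. \<alpha> n - (\<Sum>i=1..J. b i * v i n))"
  have \<beta>: "l2 \<beta>"
    unfolding \<beta>_def by (intro l2_diff l2_sum l2_cmult \<alpha> v)
  obtain R where R: "sobolev_series R"
    and sumsR: "\<And>z. norm z \<le> 1 \<Longrightarrow> (\<lambda>n. \<beta> n * (z ^ n * (poly P (a n * z) - poly P z))) sums R z"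
    using sobolev_series_perturbed_polynomial[OF a \<beta>, of P] by auto
  (* at \<zeta> j the term phi z * h z drops out, so R inherits the zero of the projected function *)
  have R0: "R (\<zeta> j) = 0" if "j \<in> {1..J}" for j
  proof -
    have "(\<lambda>n. \<beta> n * f n (\<zeta> j)) sums 0"
      using b[OF that] by (simp add: \<beta>_def v_def)
    moreover have "(\<lambda>n. \<beta> n * f n (\<zeta> j)) sums R (\<zeta> j)"
      using sumsR[of "\<zeta> j"] assms(2)[OF that] by (simp add: f root[OF that])
    ultimately show ?thesis by (rule sums_unique2[symmetric])
  qed
  define h where "h = (\<lambda>z. \<Sum>n. \<beta> n * z ^ n)"
  have decomp: "F z - (\<Sum>j=1..J. b j * kernel_of f z (\<zeta> j)) = poly P z * h z + R z"
    if z: "norm z < 1" for z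
  proof (rule sums_unique2)
    have "(\<lambda>n. \<alpha> n * f n z - (\<Sum>j=1..J. b j * (f n z * cnj (f n (\<zeta> j)))))
        sums (F z - (\<Sum>j=1..J. b j * kernel_of f z (\<zeta> j)))"
    proof (intro sums_diff sums_sum sums_mult)
      show "(\<lambda>n. \<alpha> n * f n z) sums F z" using F[of z] z by (simp add: f_def)
      show "(\<lambda>n. f n z * cnj (f n (\<zeta> j))) sums kernel_of f z (\<zeta> j)" if "j \<in> {1..J}" for j
        unfolding kernel_of_def
        using l2_mult_summable[OF l2_disc[OF z] v[OF that]]
        by (intro summable_sums) (rule summable_norm_cancel, simp add: v_def)
    qed
    moreover have "\<alpha> n * f n z - (\<Sum>j=1..J. b j * (f n z * cnj (f n (\<zeta> j)))) = \<beta> n * f n z" for n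
      unfolding \<beta>_def v_def left_diff_distrib sum_distrib_right by (simp only: mult_ac)
    ultimately show "(\<lambda>n. \<beta> n * f n z) sums (F z - (\<Sum>j=1..J. b j * kernel_of f z (\<zeta> j)))"
      by (simp only:)
    have "(\<lambda>n. poly P z * (\<beta> n * z ^ n) + \<beta> n * (z ^ n * (poly P (a n * z) - poly P z)))
        sums (poly P z * h z + R z)"
      unfolding h_def using z
      by (intro sums_add sums_mult summable_sums l2_power_series_summable \<beta> sumsR) auto
    then show "(\<lambda>n. \<beta> n * f n z) sums (poly P z * h z + R z)"
      by (simp add: f algebra_simps)
  qed
  have "inj_on (\<lambda>j. cnj (\<zeta> j)) {1..J}"
    using assms(3) by (intro inj_onI) (simp only: complex_cnj_cancel_iff inj_on_eq_iff)
  then obtain A where A: "\<And>z. (\<forall>j\<in>{1..J}. 1 - cnj (\<zeta> j) * z \<noteq> 0) \<Longrightarrow>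
      1 / phi J \<zeta> z = (\<Sum>j=1..J. A j / (1 - cnj (\<zeta> j) * z))"
    using partial_fractions_linear_factors[of "{1..J}" "\<lambda>j. cnj (\<zeta> j)"] assms(1)
    unfolding phi_def by auto
  define g where "g = (\<lambda>z. h z + (\<Sum>j=1..J. A j * (R z / (1 - cnj (\<zeta> j) * z))))"
  have "l2_series g"
    unfolding g_def h_def
    by (intro l2_series_add l2_series_suminf l2_series_sum l2_series_cmult
        l2_series_divide_boundary_zero \<beta> R R0 assms(2))
  then have "g \<in> hardy2" by (rule l2_series_imp_hardy2)
  moreover have "F z = phi J \<zeta> z * g z + (\<Sum>j=1..J. b j * kernel_of f z (\<zeta> j))"
    if z: "norm z < 1" for z
  proof -
    have nz: "1 - cnj (\<zeta> j) * z \<noteq> 0" if "j \<in> {1..J}" for j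
      by (rule boundary_factor_nonzero[OF assms(2)[OF that] z])
    then have "phi J \<zeta> z \<noteq> 0" by (simp add: phi_def)
    have "g z = h z + R z * (\<Sum>j=1..J. A j / (1 - cnj (\<zeta> j) * z))"
      by (simp add: g_def sum_distrib_left mult_ac)
    also have "\<dots> = h z + R z / phi J \<zeta> z" by (subst A[symmetric]) (use nz in auto)
    finally have "phi J \<zeta> z * g z = phi J \<zeta> z * h z + R z"
      using \<open>phi J \<zeta> z \<noteq> 0\<close> by (simp add: distrib_left)
    then show ?thesis using decomp[OF z] by (simp add: phi algebra_simps)
  qed
  ultimately show ?thesis unfolding f_def by (intro bexI[of _ g] exI[of _ b]) auto
qed

end
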